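(* For any integer $k_0>1$, there exist integers $a\ge 3$ and $m\ge 1$ such that the function $f(k)=\mu(I_{a,m}^k)$, $k\ge 1$, has a local minimum for $k=k_0$.
   Context: $K$ is a field and $\mu(L)$ denotes the minimal number of generators of a graded ideal $L$. For integers $a\ge 3$ and $m\ge 1$, $I_{a,m}=(x_1^{am},x_2^{am})(x_1^m,x_2^m)+(x_1,x_2)^{(a+2)m-1}\subset K[x_1,x_2]$. A function $f$ on the positive integers has a local minimum for $k=k_0$ (with $k_0>1$) if $f(k_0-1)>f(k_0)<f(k_0+1)$. *)

theory Defs
  imports "HOL-Computational_Algebra.Polynomial"
begin

(* Ideals of a commutative ring are the submodules of the ring regarded as a module over
   itself: ideal.subspace is the predicate "is an ideal", ideal.span S the ideal generated by S. *)

interpretation ideal: module "(*) :: 'r::comm_ring_1 \<Rightarrow> 'r \<Rightarrow> 'r"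
  by unfold_locales (simp_all add: algebra_simps)

definition ideal_add :: "'r::comm_ring_1 set \<Rightarrow> 'r set \<Rightarrow> 'r set" where
  "ideal_add I J = {u + v | u v. u \<in> I \<and> v \<in> J}"

definition ideal_mult :: "'r::comm_ring_1 set \<Rightarrow> 'r set \<Rightarrow> 'r set" where
  "ideal_mult I J = ideal.span {u * v | u v. u \<in> I \<and> v \<in> J}"

fun ideal_power :: "'r::comm_ring_1 set \<Rightarrow> nat \<Rightarrow> 'r set" where
  "ideal_power I 0 = UNIV"
| "ideal_power I (Suc k) = ideal_mult I (ideal_power I k)"

(* Meaningful only for finitely generated ideals, hence for every ideal of a Noetherian ring.
   Generators are not required to be homogeneous; for a graded ideal of a polynomial ring over
   a field this does not change the minimal number. *)
definition min_gens :: "'r::comm_ring_1 set \<Rightarrow> nat" where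
  "min_gens I = (LEAST n. \<exists>G. finite G \<and> card G = n \<and> ideal.span G = I)"

(* The type 'k poly poly is K[x1][x2] = K[x1, x2]: X1 is the inner variable, X2 the outer one. *)

definition X1 :: "'k::field poly poly" where
  "X1 = [:[:0, 1:]:]"

definition X2 :: "'k::field poly poly" where
  "X2 = [:0, 1:]"

definition I_am :: "nat \<Rightarrow> nat \<Rightarrow> 'k::field poly poly set" where
  "I_am a m =
     ideal_add
       (ideal_mult (ideal.span {X1 ^ (a * m), X2 ^ (a * m)}) (ideal.span {X1 ^ m, X2 ^ m}))
       (ideal_power (ideal.span {X1, X2}) ((a + 2) * m - 1))"

(* f is considered as a function on the positive integers; its value at 0 is irrelevant. *)
definition has_local_min_at :: "(nat \<Rightarrow> nat) \<Rightarrow> nat \<Rightarrow> bool" where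
  "has_local_min_at f k0 \<longleftrightarrow> k0 > 1 \<and> f (k0 - 1) > f k0 \<and> f k0 < f (k0 + 1)"

end

theory Submission
  imports Defs "HOL-Library.Product_Plus" "HOL-Library.Product_Order"
begin

text \<open>Write \<open>N = k (a + 1)\<close> and \<open>E\<close> for the set of all \<open>a s + t\<close> with \<open>s, t \<le> k\<close>.
  For \<open>k \<ge> 1\<close>, the \<open>k\<close>-th power of the ideal is generated by the monomials
  \<open>x\<^sub>1\<close> to the \<open>m e\<close> times \<open>x\<^sub>2\<close> to the \<open>m (N - e)\<close> with \<open>e \<in> E\<close>, together with all monomials of degree
  \<open>N m + m - 1\<close>. The former cover disjoint blocks of \<open>m\<close> monomials of that degree, so the minimal number of
  generators is \<open>|E| + m (N + 1 - |E|)\<close>. If \<open>k < a\<close> then \<open>|E| = (k + 1)\<^sup>2\<close>, and from \<open>k = a - 1\<close> on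
  \<open>E\<close> is all of \<open>{0..N}\<close>. Hence \<open>a = k\<^sub>0 + 1\<close> works as soon as \<open>m\<close> is large, and \<open>m = 6\<close> suffices.\<close>

section \<open>Products of ideals given by generators\<close>

text \<open>Multiplication is bilinear, so span induction treats one factor at a time:
  \<open>left\<close> keeps the left factor a generator, and the second induction frees it.\<close>

lemma ideal_mult_span:
  "ideal_mult (ideal.span S) (ideal.span T) = ideal.span {u * v | u v. u \<in> S \<and> v \<in> T}"
    (is "_ = ideal.span ?P")
proof
  have left: "u * v \<in> ideal.span ?P" if "u \<in> S" "v \<in> ideal.span T" for u v
    using that(2)
  proof (induction rule: ideal.span_induct_alt)
    case base
    then show ?case by (simp add: ideal.span_zero)
  next
    case (step c x y)
    have "u * x \<in> ideal.span ?P"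
      using step that(1) by (intro ideal.span_base) blast
    then have "c * (u * x) + u * y \<in> ideal.span ?P"
      by (rule ideal.span_add[OF ideal.span_scale step.IH])
    then show ?case by (simp only: distrib_left mult.left_commute)
  qed
  have "u * v \<in> ideal.span ?P" if uv: "u \<in> ideal.span S" "v \<in> ideal.span T" for u v
    using uv(1)
  proof (induction rule: ideal.span_induct_alt)
    case base
    then show ?case by (simp add: ideal.span_zero)
  next
    case (step c x y)
    have "c * (x * v) + y * v \<in> ideal.span ?P"
      using ideal.span_add[OF ideal.span_scale[OF left[OF step.hyps(1) uv(2)]] step.IH] .
    then show ?case by (simp only: distrib_right mult.assoc)
  qed
  then show "ideal_mult (ideal.span S) (ideal.span T) \<subseteq> ideal.span ?P"
    unfolding ideal_mult_def
    by (intro ideal.span_minimal ideal.subspace_span) blast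
  show "ideal.span ?P \<subseteq> ideal_mult (ideal.span S) (ideal.span T)"
    unfolding ideal_mult_def by (intro ideal.span_mono) (blast intro: ideal.span_base)
qed

lemma ideal_add_span: "ideal_add (ideal.span S) (ideal.span T) = ideal.span (S \<union> T)"
  unfolding ideal_add_def ideal.span_Un by blast

text \<open>The recursion for powers ends at the unit ideal, which is generated by \<open>1\<close>;
  this extra factor leaves every generator unchanged.\<close>

lemma ideal_power_one: "ideal_power (ideal.span S) (Suc 0) = ideal.span S"
proof -
  have "(UNIV :: 'a set) = ideal.span {1}"
    by (auto simp: ideal.span_singleton)
  then have "ideal_power (ideal.span S) (Suc 0) = ideal_mult (ideal.span S) (ideal.span {1})"
    by simp
  then show ?thesis
    unfolding ideal_mult_span by simp
qed

section \<open>Monomial ideals\<close>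

text \<open>Exponent pairs carry componentwise addition and order, so \<open>p + q\<close> stands
  for a product of monomials and \<open>p \<le> q\<close> for divisibility.\<close>

definition mon :: "nat \<times> nat \<Rightarrow> 'k::field poly poly" where
  "mon p = monom (monom 1 (fst p)) (snd p)"

definition coeff2 :: "'k::field poly poly \<Rightarrow> nat \<times> nat \<Rightarrow> 'k" where
  "coeff2 f p = coeff (coeff f (snd p)) (fst p)"

definition monomial_ideal :: "(nat \<times> nat) set \<Rightarrow> 'k::field poly poly set" where
  "monomial_ideal A = ideal.span (mon ` A)"

lemma mon_add: "mon (p + q) = mon p * mon q"
  by (simp add: mon_def mult_monom)

lemma coeff2_mon: "coeff2 (mon p) q = (if p = q then 1 else 0)"
  by (auto simp: coeff2_def mon_def prod_eq_iff)

lemma inj_mon: "inj (mon :: _ \<Rightarrow> 'k::field poly poly)"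
proof (rule injI)
  fix p q :: "nat \<times> nat"
  assume "(mon p :: 'k poly poly) = mon q"
  then have "coeff2 (mon p :: 'k poly poly) q = 1"
    by (simp add: coeff2_mon)
  then show "p = q"
    by (simp add: coeff2_mon split: if_splits)
qed

lemma coeff2_add: "coeff2 (f + g) p = coeff2 f p + coeff2 g p"
  by (simp add: coeff2_def)

lemma coeff2_zero: "coeff2 0 p = 0"
  by (simp add: coeff2_def)

lemma coeff2_sum: "coeff2 (\<Sum>x\<in>S. f x) p = (\<Sum>x\<in>S. coeff2 (f x) p)"
  by (simp add: coeff2_def coeff_sum)

lemma coeff2_smult: "coeff2 (smult [:c:] f) p = c * coeff2 f p"
  by (simp add: coeff2_def)

lemma coeff2_mult:
  "coeff2 (f * g) (i, j) = (\<Sum>v\<le>j. \<Sum>u\<le>i. coeff2 f (u, v) * coeff2 g (i - u, j - v))"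
  by (simp add: coeff2_def coeff_mult coeff_sum)

lemma monomial_ideal_support:
  assumes "f \<in> monomial_ideal A" "coeff2 f q \<noteq> 0"
  shows "\<exists>p\<in>A. p \<le> q"
proof -
  have "\<forall>q. coeff2 f q \<noteq> 0 \<longrightarrow> (\<exists>p\<in>A. p \<le> q)"
    using assms(1) unfolding monomial_ideal_def
  proof (induction rule: ideal.span_induct_alt)
    case base
    then show ?case by (simp add: coeff2_zero)
  next
    case (step c x y)
    obtain p where p: "p \<in> A" "x = mon p"
      using step(1) by blast
    show ?case
    proof (intro allI impI)
      fix q
      assume nz: "coeff2 (c * x + y) q \<noteq> 0"
      obtain i j where q: "q = (i, j)" by (cases q)
      show "\<exists>p\<in>A. p \<le> q"
      proof (cases "coeff2 y q = 0")
        case True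
        then have "(\<Sum>v\<le>j. \<Sum>u\<le>i. coeff2 c (u, v) * coeff2 x (i - u, j - v)) \<noteq> 0"
          using nz by (simp add: coeff2_add q coeff2_mult)
        \<comment> \<open>A nonzero convolution has a nonzero summand, and its second factor is a
          coefficient of \<open>mon p\<close>. This locates \<open>p\<close> below
          \<open>q\<close>.\<close>
        then obtain v u where "coeff2 x (i - u, j - v) \<noteq> 0"
          by (metis (no_types, lifting) mult_zero_right sum.neutral)
        then have "p = (i - u, j - v)"
          by (simp add: p coeff2_mon split: if_splits)
        then have "p \<le> q"
          by (simp add: q)
        then show ?thesis using p by blast
      qed (use step in blast)
    qed
  qed
  then show ?thesis using assms(2) by blast
qed

lemma monomial_ideal_subset:
  assumes "\<And>q. q \<in> B \<Longrightarrow> \<exists>p\<in>A. p \<le> q"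
  shows "monomial_ideal B \<subseteq> monomial_ideal A"
  unfolding monomial_ideal_def
proof (intro ideal.span_minimal ideal.subspace_span image_subsetI)
  fix q assume "q \<in> B"
  then obtain p where p: "p \<in> A" "p \<le> q" using assms by blast
  then have "q = (q - p) + p"
    by (auto simp: prod_eq_iff less_eq_prod_def)
  then have "mon q = mon (q - p) * mon p"
    unfolding mon_add[symmetric] by (rule arg_cong)
  moreover have "mon (q - p) * mon p \<in> ideal.span (mon ` A)"
    using p(1) by (intro ideal.span_scale[OF ideal.span_base] imageI)
  ultimately show "mon q \<in> ideal.span (mon ` A)"
    by (rule ssubst)
qed

lemma monomial_ideal_eqI:
  assumes "\<And>q. q \<in> B \<Longrightarrow> \<exists>p\<in>A. p \<le> q" "\<And>p. p \<in> A \<Longrightarrow> \<exists>q\<in>B. q \<le> p"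
  shows "monomial_ideal A = monomial_ideal B"
  by (intro equalityI monomial_ideal_subset assms)

lemma monomial_ideal_mult:
  "ideal_mult (monomial_ideal A) (monomial_ideal B :: 'k::field poly poly set) =
    monomial_ideal {p + q | p q. p \<in> A \<and> q \<in> B}"
proof -
  have "{u * v | u v :: 'k poly poly. u \<in> mon ` A \<and> v \<in> mon ` B} = (\<lambda>(p, q). mon (p + q)) ` (A \<times> B)"
    unfolding mon_add by auto
  also have "\<dots> = mon ` {p + q | p q. p \<in> A \<and> q \<in> B}"
    by (force simp del: add_Pair)
  finally have "{u * v | u v :: 'k poly poly. u \<in> mon ` A \<and> v \<in> mon ` B} = mon ` {p + q | p q. p \<in> A \<and> q \<in> B}" .
  then show ?thesis
    unfolding monomial_ideal_def ideal_mult_span by simp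
qed

lemma monomial_ideal_add: "ideal_add (monomial_ideal A) (monomial_ideal B) = monomial_ideal (A \<union> B)"
  by (simp add: monomial_ideal_def ideal_add_span image_Un)

section \<open>The number of generators of a monomial ideal\<close>

text \<open>Numbers of ideal generators are bounded below by linear algebra over the field, whose
  elements act as the constants \<open>[:[:c:]:]\<close>.\<close>

interpretation kvec: vector_space "\<lambda>(c::'k::field) (f::'k poly poly). smult [:c:] f"
  by unfold_locales (simp_all add: smult_add_right smult_add_left[symmetric] mult.commute flip: one_pCons)

lemma independent_mon:
  assumes "finite A"
  shows "kvec.independent (mon ` A)"
proof
  assume "kvec.dependent (mon ` A :: 'a poly poly set)"
  then obtain u p where u: "(\<Sum>v\<in>mon ` A. smult [:u v:] v) = (0 :: 'a poly poly)"
    and p: "p \<in> A" "u (mon p) \<noteq> 0"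
    using assms by (auto simp: kvec.dependent_finite)
  have "0 = coeff2 (\<Sum>v\<in>mon ` A. smult [:u v:] v) p"
    by (simp add: u coeff2_zero)
  also have "\<dots> = (\<Sum>q\<in>A. u (mon q) * coeff2 (mon q) p)"
    by (simp add: coeff2_sum coeff2_smult sum.reindex inj_on_subset[OF inj_mon])
  also have "\<dots> = (\<Sum>q\<in>A. if q = p then u (mon q) else 0)"
    by (intro sum.cong) (auto simp: coeff2_mon)
  also have "\<dots> = u (mon p)"
    using assms p by simp
  finally show False using p by simp
qed

text \<open>If \<open>f\<close> lies in the ideal, minimality of the exponents in \<open>A\<close> forces
  the coefficients of \<open>h * f\<close> at \<open>A\<close> to be those of \<open>f\<close> times the constant term of \<open>h\<close>.
  So the coefficients at \<open>A\<close> of any generators span the space of all coefficient vectors.\<close>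

lemma card_antichain_le_generators:
  fixes G :: "'k::field poly poly set"
  assumes A: "finite A" "\<And>p q. p \<in> A \<Longrightarrow> q \<in> A \<Longrightarrow> p \<le> q \<Longrightarrow> p = q"
    and G: "finite G" "ideal.span G = monomial_ideal A"
  shows "card A \<le> card G"
proof -
  \<comment> \<open>\<open>\<phi>\<close> keeps only the terms with exponents in \<open>A\<close>;
    the coefficient vector indexed by \<open>A\<close> is thus represented by a polynomial.\<close>
  define \<phi> :: "'k poly poly \<Rightarrow> 'k poly poly" where
    "\<phi> f = (\<Sum>p\<in>A. smult [:coeff2 f p:] (mon p))" for f
  have coeff_mult: "coeff2 (h * f) q = coeff2 h (0, 0) * coeff2 f q"
    if f: "f \<in> monomial_ideal A" and q: "q \<in> A" for h f q
  proof -
    obtain i j where ij: "q = (i, j)" by (cases q)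
    have zero: "coeff2 f (i - u, j - v) = 0" if uv: "u \<le> i" "v \<le> j" "(u, v) \<noteq> (0, 0)" for u v
    proof (rule ccontr)
      assume "coeff2 f (i - u, j - v) \<noteq> 0"
      then obtain p where p: "p \<in> A" "p \<le> (i - u, j - v)"
        using monomial_ideal_support[OF f] by blast
      moreover have "(i - u, j - v) \<le> q" by (simp add: ij)
      ultimately have "p = q" using A(2) q order_trans by blast
      then show False using p(2) uv ij by auto
    qed
    have "coeff2 (h * f) q = (\<Sum>v\<le>j. \<Sum>u\<le>i. coeff2 h (u, v) * coeff2 f (i - u, j - v))"
      by (simp add: ij coeff2_mult)
    also have "\<dots> = (\<Sum>v\<le>j. \<Sum>u\<le>i. if v = 0 then if u = 0 then coeff2 h (0, 0) * coeff2 f (i, j) else 0 else 0)"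
    proof (intro sum.cong refl)
      fix v u
      assume "v \<in> {..j}" "u \<in> {..i}"
      then show "coeff2 h (u, v) * coeff2 f (i - u, j - v) =
        (if v = 0 then if u = 0 then coeff2 h (0, 0) * coeff2 f (i, j) else 0 else 0)"
        using zero[of u v] by (cases "(u, v) = (0, 0)") auto
    qed
    also have "\<dots> = (\<Sum>v\<le>j. if v = 0 then coeff2 h (0, 0) * coeff2 f (i, j) else 0)"
      by (intro sum.cong refl) auto
    also have "\<dots> = coeff2 h (0, 0) * coeff2 f q"
      by (simp add: ij)
    finally show ?thesis .
  qed
  have span: "\<phi> f \<in> kvec.span (\<phi> ` G)" if "f \<in> ideal.span G" for f
    using that
  proof (induction rule: ideal.span_induct_alt)
    case base
    then show ?case by (simp add: \<phi>_def coeff2_zero kvec.span_zero)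
  next
    case (step c x y)
    then have "x \<in> monomial_ideal A"
      using G ideal.span_base by blast
    \<comment> \<open>On the ideal, a polynomial factor acts on \<open>\<phi>\<close> as a scalar,
      so ring combinations become linear combinations over the field.\<close>
    then have "\<phi> (c * x + y) = smult [:coeff2 c (0, 0):] (\<phi> x) + \<phi> y"
      unfolding \<phi>_def kvec.scale_sum_right sum.distrib[symmetric]
      by (intro sum.cong refl) (simp add: coeff2_add coeff_mult smult_add_left[symmetric])
    then show ?case
      using step by (simp add: kvec.span_add kvec.span_scale kvec.span_base)
  qed
  have "mon ` A \<subseteq> kvec.span (\<phi> ` G)"
  proof (rule image_subsetI)
    fix p assume p: "p \<in> A"
    have "\<phi> (mon p) = (\<Sum>q\<in>A. if q = p then mon q else 0)"
      unfolding \<phi>_def by (intro sum.cong) (auto simp: coeff2_mon)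
    then have "\<phi> (mon p) = mon p"
      using p A(1) by simp
    moreover have "mon p \<in> ideal.span G"
      using p by (simp add: G monomial_ideal_def ideal.span_base)
    ultimately show "mon p \<in> kvec.span (\<phi> ` G)"
      using span by metis
  qed
  then have "card (mon ` A :: 'k poly poly set) \<le> card (\<phi> ` G)"
    using kvec.independent_span_bound[OF finite_imageI[OF G(1), of \<phi>] independent_mon[OF A(1)]] by blast
  also have "\<dots> \<le> card G"
    using G(1) by (rule card_image_le)
  finally show ?thesis
    by (simp add: card_image inj_on_subset[OF inj_mon])
qed

text \<open>The monomials themselves attain the number, and the preceding bound excludes any smaller
  generating set, monomial or not.\<close>

lemma min_gens_monomial_ideal:
  assumes "finite A" "\<And>p q. p \<in> A \<Longrightarrow> q \<in> A \<Longrightarrow> p \<le> q \<Longrightarrow> p = q"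
  shows "min_gens (monomial_ideal A :: 'k::field poly poly set) = card A"
  unfolding min_gens_def
proof (rule Least_equality)
  show "\<exists>G. finite G \<and> card G = card A \<and> ideal.span G = (monomial_ideal A :: 'k poly poly set)"
    using assms(1)
    by (intro exI[of _ "mon ` A"]) (simp add: monomial_ideal_def card_image inj_on_subset[OF inj_mon])
qed (use card_antichain_le_generators[OF assms] in blast)

section \<open>The powers of the ideal\<close>

lemma X1_power: "X1 ^ n = mon (n, 0)"
  by (induction n) (simp_all add: X1_def mon_def monom_Suc monom_0 flip: one_pCons)

lemma X2_power: "X2 ^ n = mon (0, n)"
  by (induction n) (simp_all add: X2_def mon_def monom_Suc monom_0 flip: one_pCons)

lemma span_X1_X2_powers: "ideal.span {X1 ^ i, X2 ^ j} = monomial_ideal {(i, 0), (0, j)}"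
  by (simp add: monomial_ideal_def X1_power X2_power)

lemma maximal_ideal_power:
  "ideal_power (ideal.span {X1, X2 :: 'k::field poly poly}) n = monomial_ideal {p. fst p + snd p = n}"
proof (induction n)
  case 0
  have "{p :: nat \<times> nat. fst p + snd p = 0} = {(0, 0)}"
    by (auto simp: prod_eq_iff)
  moreover have "(mon (0, 0) :: 'k poly poly) = 1"
    by (simp add: mon_def monom_0 flip: one_pCons)
  ultimately show ?case
    by (auto simp: monomial_ideal_def ideal.span_singleton)
next
  case (Suc n)
  have X: "ideal.span {X1, X2 :: 'k poly poly} = monomial_ideal {(1, 0), (0, 1)}"
    using span_X1_X2_powers[of 1 1] by simp
  have "{p + q | p q. p \<in> {(1, 0), (0, 1)} \<and> q \<in> {p. fst p + snd p = n}}
    = {p :: nat \<times> nat. fst p + snd p = Suc n}" (is "?L = ?R")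
  proof
    show "?R \<subseteq> ?L"
    proof
      fix r :: "nat \<times> nat"
      assume r: "r \<in> ?R"
      obtain i j where ij: "r = (i, j)" by (cases r)
      show "r \<in> ?L"
      proof (cases i)
        case 0
        then have "r = (0, 1) + (0, n)"
          using r ij by simp
        then show ?thesis by fastforce
      next
        case (Suc i')
        then have "r = (1, 0) + (i', j)" "i' + j = n"
          using r ij by auto
        then show ?thesis by fastforce
      qed
    qed
  qed auto
  then show ?case
    unfolding ideal_power.simps(2) Suc unfolding X monomial_ideal_mult by simp
qed

section \<open>Exponents and generators of the powers\<close>

definition expo :: "nat \<Rightarrow> nat \<Rightarrow> nat set" where
  "expo a k = {a * s + t | s t. s \<le> k \<and> t \<le> k}"

text \<open>These are the products of \<open>k\<close> choices from \<open>X1 ^ (a * m)\<close>,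
  \<open>X2 ^ (a * m)\<close> and \<open>k\<close> choices from \<open>X1 ^ m\<close>,
  \<open>X2 ^ m\<close>; in \<open>expo\<close>, \<open>s\<close> and \<open>t\<close> count the
  choices of a power of \<open>X1\<close>.\<close>

definition low_gens :: "nat \<Rightarrow> nat \<Rightarrow> nat \<Rightarrow> (nat \<times> nat) set" where
  "low_gens a m k = (\<lambda>e. (m * e, m * (k * (a + 1) - e))) ` expo a k"

text \<open>This is the degree of one generator of degree \<open>(a + 2) * m - 1\<close> times
  \<open>k - 1\<close> low generators of degree \<open>(a + 1) * m\<close>.\<close>

definition top_degree :: "nat \<Rightarrow> nat \<Rightarrow> nat \<Rightarrow> nat" where
  "top_degree a m k = k * (a + 1) * m + m - 1"

definition degree_gens :: "nat \<Rightarrow> (nat \<times> nat) set" where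
  "degree_gens d = {p. fst p + snd p = d}"

lemma expo_le: "e \<in> expo a k \<Longrightarrow> e \<le> k * (a + 1)"
proof -
  assume "e \<in> expo a k"
  then obtain s t where "e = a * s + t" "s \<le> k" "t \<le> k"
    by (auto simp: expo_def)
  then show ?thesis
    using add_le_mono[OF mult_le_mono2[of s k a], of t k] by (simp add: algebra_simps)
qed

lemma expo_add:
  assumes "e \<in> expo a k" "e' \<in> expo a l"
  shows "e + e' \<in> expo a (k + l)"
proof -
  obtain s t where "e = a * s + t" "s \<le> k" "t \<le> k"
    using assms(1) by (auto simp: expo_def)
  moreover obtain s' t' where "e' = a * s' + t'" "s' \<le> l" "t' \<le> l"
    using assms(2) by (auto simp: expo_def)
  ultimately have "e + e' = a * (s + s') + (t + t')" "s + s' \<le> k + l" "t + t' \<le> k + l"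
    by (auto simp: algebra_simps)
  then show ?thesis unfolding expo_def by blast
qed

lemma expo_one: "expo a 1 = {0, 1, a, a + 1}"
  unfolding expo_def by (force simp: le_Suc_eq)

lemma expo_Suc:
  assumes "e \<in> expo a (Suc k)"
  obtains e1 e2 where "e1 \<in> expo a 1" "e2 \<in> expo a k" "e = e1 + e2"
proof -
  obtain s t where st: "e = a * s + t" "s \<le> Suc k" "t \<le> Suc k"
    using assms by (auto simp: expo_def)
  \<comment> \<open>\<open>min s 1\<close> and the truncated \<open>s - 1\<close> add up to
    \<open>s\<close> even for \<open>s = 0\<close>, and likewise for \<open>t\<close>.\<close>
  have "a * min s 1 + min t 1 \<in> expo a 1"
    unfolding expo_def by (rule CollectI) (intro exI conjI, rule refl, auto)
  moreover have "a * (s - 1) + (t - 1) \<in> expo a k"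
    unfolding expo_def using st(2,3) by force
  moreover have "e = (a * min s 1 + min t 1) + (a * (s - 1) + (t - 1))"
    using st by (cases s; cases t) auto
  ultimately show ?thesis using that by blast
qed

lemma low_gens_degree: "p \<in> low_gens a m k \<Longrightarrow> fst p + snd p = k * (a + 1) * m"
proof -
  assume "p \<in> low_gens a m k"
  then obtain e where e: "e \<in> expo a k" "p = (m * e, m * (k * (a + 1) - e))"
    by (auto simp: low_gens_def)
  then have "fst p + snd p = m * (e + (k * (a + 1) - e))"
    by (simp add: add_mult_distrib2)
  then show ?thesis
    using expo_le[OF e(1)] by (simp add: mult.commute)
qed

lemma low_gens_add:
  assumes "p \<in> low_gens a m k" "q \<in> low_gens a m l"
  shows "p + q \<in> low_gens a m (k + l)"
proof -
  obtain e f where e: "e \<in> expo a k" "p = (m * e, m * (k * (a + 1) - e))"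
    and f: "f \<in> expo a l" "q = (m * f, m * (l * (a + 1) - f))"
    using assms by (auto simp: low_gens_def)
  have "(k * (a + 1) - e) + (l * (a + 1) - f) = (k + l) * (a + 1) - (e + f)"
    using expo_le[OF e(1)] expo_le[OF f(1)] by (simp add: algebra_simps)
  then have "p + q = (m * (e + f), m * ((k + l) * (a + 1) - (e + f)))"
    by (simp add: e f add_mult_distrib2[symmetric])
  then show ?thesis
    using expo_add[OF e(1) f(1)] unfolding low_gens_def by blast
qed

lemma low_gens_Suc:
  assumes "r \<in> low_gens a m (Suc k)"
  obtains p q where "p \<in> low_gens a m 1" "q \<in> low_gens a m k" "r = p + q"
proof -
  obtain e where e: "e \<in> expo a (Suc k)" "r = (m * e, m * (Suc k * (a + 1) - e))"
    using assms by (auto simp: low_gens_def)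
  obtain f g where f: "f \<in> expo a 1" and g: "g \<in> expo a k" and efg: "e = f + g"
    using expo_Suc[OF e(1)] .
  have "Suc k * (a + 1) - e = (1 * (a + 1) - f) + (k * (a + 1) - g)"
    using expo_le[OF f] expo_le[OF g] by (simp add: efg)
  then have "r = (m * f, m * (1 * (a + 1) - f)) + (m * g, m * (k * (a + 1) - g))"
    by (simp only: e efg add_mult_distrib2 add_Pair)
  then show ?thesis
    using that f g unfolding low_gens_def by blast
qed

lemma degree_gens_below:
  assumes "d \<le> fst p + snd p"
  shows "\<exists>q\<in>degree_gens d. q \<le> p"
  using assms
  \<comment> \<open>The witness takes as much of the first exponent as \<open>d\<close> allows and
    fills up with the second.\<close>
  by (intro bexI[of _ "(min (fst p) d, d - min (fst p) d)"])
     (auto simp: degree_gens_def less_eq_prod_def)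

lemma I_am_eq:
  assumes "m \<ge> 1"
  shows "(I_am a m :: 'k::field poly poly set) =
    monomial_ideal (low_gens a m 1 \<union> degree_gens (top_degree a m 1))"
proof -
  have deg: "(a + 2) * m - 1 = top_degree a m 1"
    by (simp add: top_degree_def algebra_simps)
  have "{p + q | p q. p \<in> {(a * m, 0), (0, a * m)} \<and> q \<in> {(m, 0), (0, m)}}
    = {(a * m + m, 0), (a * m, m), (m, a * m), (0, a * m + m)}"
    by (auto simp: ex_disj_distrib conj_disj_distribL conj_disj_distribR)
  also have "\<dots> = low_gens a m 1"
    unfolding low_gens_def expo_one by (auto simp: algebra_simps)
  finally have low: "{p + q | p q. p \<in> {(a * m, 0), (0, a * m)} \<and> q \<in> {(m, 0), (0, m)}}
    = low_gens a m 1" .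
  show ?thesis
    unfolding I_am_def span_X1_X2_powers monomial_ideal_mult maximal_ideal_power
      monomial_ideal_add low deg degree_gens_def ..
qed

text \<open>In the induction step, products of low generators are low, and all other products reach
  the new top degree. Conversely, each monomial of that degree is divisible by the low generator
  \<open>X1 ^ ((a + 1) * m)\<close> or \<open>X2 ^ ((a + 1) * m)\<close>, with a quotient of the old
  top degree.\<close>

lemma I_am_power:
  assumes "m \<ge> 1"
  shows "ideal_power (I_am a m :: 'k::field poly poly set) (Suc k) =
    monomial_ideal (low_gens a m (Suc k) \<union> degree_gens (top_degree a m (Suc k)))"
proof (induction k)
  case 0
  show ?case
    unfolding I_am_eq[OF assms] monomial_ideal_def ideal_power_one by simp
next
  case (Suc k)
  let ?B = "\<lambda>k. low_gens a m k \<union> degree_gens (top_degree a m k)"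
  let ?P = "{p + q | p q. p \<in> ?B 1 \<and> q \<in> ?B (Suc k)}"
  have top: "top_degree a m (Suc (Suc k)) = top_degree a m (Suc k) + (a + 1) * m"
    "top_degree a m (Suc (Suc k)) = top_degree a m 1 + Suc k * (a + 1) * m"
    "(a + 1) * m \<le> top_degree a m (Suc k)"
    using assms by (simp_all add: top_degree_def algebra_simps)
  have "monomial_ideal ?P = (monomial_ideal (?B (Suc (Suc k))) :: 'k poly poly set)"
  proof (rule monomial_ideal_eqI)
    fix r assume "r \<in> ?B (Suc (Suc k))"
    then show "\<exists>p\<in>?P. p \<le> r"
    proof
      assume "r \<in> low_gens a m (Suc (Suc k))"
      then show ?thesis
        by (rule low_gens_Suc) blast
    next
      assume r: "r \<in> degree_gens (top_degree a m (Suc (Suc k)))"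
      obtain i j where ij: "r = (i, j)" by (cases r)
      have "(0, (a + 1) * m) \<in> low_gens a m 1" "((a + 1) * m, 0) \<in> low_gens a m 1"
        unfolding low_gens_def expo_one by (auto simp: algebra_simps)
      moreover have "\<exists>q. q \<in> degree_gens (top_degree a m (Suc k)) \<and>
        (r = (0, (a + 1) * m) + q \<or> r = ((a + 1) * m, 0) + q)"
      proof (cases "(a + 1) * m \<le> i")
        case True
        then show ?thesis
          using r top(1) ij by (intro exI[of _ "(i - (a + 1) * m, j)"]) (auto simp: degree_gens_def)
      next
        case False
        \<comment> \<open>The total degree is at least twice \<open>(a + 1) * m\<close>, so one of
          the two exponents is large enough.\<close>
        then have "(a + 1) * m \<le> j"
          using r top ij by (auto simp: degree_gens_def)
        then show ?thesis
          using r top(1) ij by (intro exI[of _ "(i, j - (a + 1) * m)"]) (auto simp: degree_gens_def)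
      qed
      ultimately show ?thesis by blast
    qed
  next
    fix r assume "r \<in> ?P"
    then obtain p q where pq: "p \<in> ?B 1" "q \<in> ?B (Suc k)" "r = p + q" by blast
    show "\<exists>q\<in>?B (Suc (Suc k)). q \<le> r"
    proof (cases "p \<in> low_gens a m 1 \<and> q \<in> low_gens a m (Suc k)")
      case True
      then have "r \<in> low_gens a m (Suc (Suc k))"
        using low_gens_add[of p a m 1 q "Suc k"] pq by simp
      then show ?thesis by blast
    next
      case False
      have p: "fst p + snd p = (if p \<in> low_gens a m 1 then (a + 1) * m else top_degree a m 1)"
        using pq(1) low_gens_degree[of p a m 1] by (auto simp: degree_gens_def)
      have q: "fst q + snd q = (if q \<in> low_gens a m (Suc k) then Suc k * (a + 1) * m else top_degree a m (Suc k))"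
        using pq(2) low_gens_degree[of q a m "Suc k"] by (auto simp: degree_gens_def)
      have "(a + 1) * m \<le> top_degree a m 1"
        using assms by (simp add: top_degree_def)
      then have "top_degree a m (Suc (Suc k)) \<le> (fst p + snd p) + (fst q + snd q)"
        using False top unfolding p q by auto
      then have "top_degree a m (Suc (Suc k)) \<le> fst r + snd r"
        by (simp add: pq)
      then show ?thesis
        using degree_gens_below by blast
    qed
  qed
  then show ?case
    unfolding ideal_power.simps(2)[of _ "Suc k"] Suc unfolding I_am_eq[OF assms] monomial_ideal_mult .
qed

text \<open>In degree \<open>top_degree a m k\<close>, the generator with exponent \<open>m * e\<close> of \<open>x\<^sub>1\<close> divides exactly the
  monomials whose exponent \<open>c\<close> of \<open>x\<^sub>1\<close> satisfies \<open>c div m = e\<close>.\<close>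

lemma min_gens_I_am_power:
  assumes m: "m \<ge> 1" and k: "k \<ge> 1"
  shows "min_gens (ideal_power (I_am a m :: 'k::field poly poly set) k) =
    card (expo a k) + m * (k * (a + 1) + 1 - card (expo a k))"
proof -
  let ?N = "k * (a + 1)"
  let ?D = "top_degree a m k"
  let ?C = "{c. c div m \<le> ?N \<and> c div m \<notin> expo a k}"
  \<comment> \<open>\<open>H\<close> consists of the monomials of degree \<open>?D\<close> that no
    low generator divides.\<close>
  define H where "H = (\<lambda>c. (c, ?D - c)) ` ?C"
  \<comment> \<open>The exponents \<open>0\<close> to \<open>?D\<close> thus split into exactly
    \<open>?N + 1\<close> full blocks of length \<open>m\<close>.\<close>
  have D: "?D + 1 = m * (?N + 1)"
    using m by (simp add: top_degree_def algebra_simps)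
  have le_D: "c \<le> ?D \<longleftrightarrow> c div m \<le> ?N" for c
  proof -
    have "c \<le> ?D \<longleftrightarrow> c < (?N + 1) * m"
      using D by (simp add: mult.commute) linarith
    also have "\<dots> \<longleftrightarrow> c div m < ?N + 1"
      using m by (simp add: div_less_iff_less_mult)
    finally show ?thesis by linarith
  qed
  have H_degree: "fst p + snd p = ?D" if "p \<in> H" for p
    using that le_D by (auto simp: H_def)
  have low_le: "(m * e, m * (?N - e)) \<le> (c, ?D - c) \<longleftrightarrow> c div m = e" if "c \<le> ?D" "e \<le> ?N" for c e
  proof -
    have "m * e + m * (?N - e) = m * ?N"
      using that by (simp add: add_mult_distrib2[symmetric])
    then have "(m * e, m * (?N - e)) \<le> (c, ?D - c) \<longleftrightarrow> m * e \<le> c \<and> c < m * e + m"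
      using D that m by auto
    also have "\<dots> \<longleftrightarrow> c div m = e"
      using m dividend_less_times_div[of m c] by (auto intro: div_nat_eqI simp: mult.commute)
    finally show ?thesis .
  qed
  have finite: "finite (expo a k)"
    by (rule finite_subset[of _ "{..?N}"]) (auto dest: expo_le)
  have finite_C: "finite ?C"
    by (rule finite_subset[of _ "{..?D}"]) (auto simp: le_D)
  have "monomial_ideal (low_gens a m k \<union> degree_gens ?D) =
    (monomial_ideal (low_gens a m k \<union> H) :: 'k poly poly set)"
  proof (rule monomial_ideal_eqI)
    fix q assume "q \<in> low_gens a m k \<union> H"
    then have "q \<in> low_gens a m k \<union> degree_gens ?D"
      using H_degree by (auto simp: degree_gens_def)
    then show "\<exists>p\<in>low_gens a m k \<union> degree_gens ?D. p \<le> q" by blast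
  next
    fix q assume "q \<in> low_gens a m k \<union> degree_gens ?D"
    then show "\<exists>p\<in>low_gens a m k \<union> H. p \<le> q"
    proof
      assume "q \<in> degree_gens ?D"
      then obtain c where c: "q = (c, ?D - c)" "c \<le> ?D"
        by (cases q) (auto simp: degree_gens_def)
      show ?thesis
      proof (cases "c div m \<in> expo a k")
        case True
        then show ?thesis
          using low_le[of c "c div m"] c le_D unfolding low_gens_def by blast
      next
        case False
        then have "q \<in> H" using c le_D by (simp add: H_def)
        then show ?thesis by blast
      qed
    qed blast
  qed
  moreover have "min_gens (monomial_ideal (low_gens a m k \<union> H) :: 'k poly poly set)
    = card (low_gens a m k \<union> H)"
  proof (rule min_gens_monomial_ideal)
    show "finite (low_gens a m k \<union> H)"
      using finite finite_C by (simp add: low_gens_def H_def)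
  next
    fix p q assume pq: "p \<in> low_gens a m k \<union> H" "q \<in> low_gens a m k \<union> H" "p \<le> q"
    have same: "p = q" if "fst p + snd p = fst q + snd q"
      using that pq(3) by (auto simp: less_eq_prod_def prod_eq_iff)
    consider "p \<in> low_gens a m k" "q \<in> low_gens a m k" | "p \<in> H" "q \<in> H"
      | "p \<in> low_gens a m k" "q \<in> H" | "p \<in> H" "q \<in> low_gens a m k"
      using pq by blast
    then show "p = q"
    proof cases
      case 3
      then obtain e c where "e \<in> expo a k" "p = (m * e, m * (?N - e))" "c \<in> ?C" "q = (c, ?D - c)"
        by (auto simp: low_gens_def H_def)
      then have False
        using pq(3) low_le[of c e] expo_le[of e a k] le_D[of c] by auto
      then show ?thesis ..
    next
      case 4
      \<comment> \<open>This forces \<open>m = 1\<close>; then both degrees agree and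
        \<open>same\<close> applies.\<close>
      have "?D \<le> ?N * m"
        using pq(3) H_degree[OF 4(1)] low_gens_degree[OF 4(2)] by (auto simp: less_eq_prod_def)
      then show ?thesis
        using same H_degree[OF 4(1)] low_gens_degree[OF 4(2)] m by (simp add: top_degree_def)
    qed (use same H_degree low_gens_degree in auto)
  qed
  moreover have "card (low_gens a m k \<union> H) = card (expo a k) + m * (?N + 1 - card (expo a k))"
  proof -
    \<comment> \<open>For \<open>m = 1\<close> degrees do not separate the two sets, but
      \<open>c = m * e\<close> gives \<open>c div m = e\<close>, which is excluded in
      \<open>?C\<close>.\<close>
    have "low_gens a m k \<inter> H = {}"
    proof -
      have False if "e \<in> expo a k" "c \<in> ?C" "m * e = c" for e c
        using that m by auto
      then show ?thesis by (auto simp: low_gens_def H_def)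
    qed
    moreover have "card (low_gens a m k) = card (expo a k)"
      unfolding low_gens_def using m by (intro card_image inj_onI) auto
    moreover have "card H = card ?C"
      unfolding H_def by (intro card_image inj_onI) auto
    moreover have "card ?C = m * (?N + 1 - card (expo a k))"
    proof -
      \<comment> \<open>Division with remainder: each gap of \<open>expo a k\<close> contributes a
        whole block of \<open>m\<close> exponents.\<close>
      have "bij_betw (\<lambda>(e, r). m * e + r) (({..?N} - expo a k) \<times> {..<m}) ?C"
        by (rule bij_betw_byWitness[where f' = "\<lambda>c. (c div m, c mod m)"]) (use m in auto)
      then have "card ?C = card (({..?N} - expo a k) \<times> {..<m})"
        by (simp add: bij_betw_same_card)
      also have "\<dots> = (?N + 1 - card (expo a k)) * m"
        using finite expo_le by (subst card_cartesian_product, subst card_Diff_subset) auto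
      finally show ?thesis by (simp add: mult.commute)
    qed
    ultimately show ?thesis
      using finite finite_C by (subst card_Un_disjoint) (auto simp: low_gens_def H_def)
  qed
  moreover obtain k' where "k = Suc k'" using k by (cases k) auto
  ultimately show ?thesis
    using I_am_power[OF m, of a k', where 'k = 'k] by simp
qed

section \<open>The size of the exponent set\<close>

lemma card_expo_small:
  assumes "k < a"
  shows "card (expo a k) = (k + 1)\<^sup>2"
proof -
  have "expo a k = (\<lambda>(s, t). a * s + t) ` ({..k} \<times> {..k})"
    unfolding expo_def by auto
  \<comment> \<open>Since \<open>t \<le> k < a\<close>, quotient and remainder by \<open>a\<close>
    recover \<open>s\<close> and \<open>t\<close>.\<close>
  moreover have "inj_on (\<lambda>(s, t). a * s + t) ({..k} \<times> {..k})"
    by (rule inj_on_inverseI[where g = "\<lambda>e. (e div a, e mod a)"]) (use assms in auto)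
  ultimately show ?thesis
    by (simp add: card_image power2_eq_square)
qed

text \<open>Below \<open>a * k\<close>, quotient and remainder by \<open>a\<close> serve as
  \<open>s\<close> and \<open>t\<close>, as the remainder is at most \<open>a - 1 \<le> k\<close>;
  from \<open>a * k\<close> on, \<open>s = k\<close> works.\<close>

lemma expo_large:
  assumes "a \<ge> 1" "a \<le> k + 1"
  shows "expo a k = {..k * (a + 1)}"
proof
  show "{..k * (a + 1)} \<subseteq> expo a k"
  proof
    fix e assume e: "e \<in> {..k * (a + 1)}"
    show "e \<in> expo a k"
    proof (cases "a * k \<le> e")
      case True
      then have "e = a * k + (e - a * k)" "e - a * k \<le> k"
        using e by (auto simp: algebra_simps)
      then show ?thesis unfolding expo_def by blast
    next
      case False
      then have "e div a \<le> k"
        using assms by (simp add: less_mult_imp_div_less mult.commute less_imp_le)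
      moreover have "e mod a \<le> k"
        using assms mod_less_divisor[of a e] by linarith
      moreover have "e = a * (e div a) + e mod a" by simp
      ultimately show ?thesis unfolding expo_def by blast
    qed
  qed
qed (auto dest: expo_le)

section \<open>Choice of the parameters\<close>

theorem corollary2p9:
  fixes k0 :: nat
  assumes "k0 > 1"
  shows "\<exists>a m :: nat. a \<ge> 3 \<and> m \<ge> 1 \<and>
    has_local_min_at (\<lambda>k. min_gens (ideal_power (I_am a m :: 'k::field poly poly set) k)) k0"
proof -
  obtain n where n: "k0 = n + 2"
    using assms by (metis add.commute add_2_eq_Suc less_iff_Suc_add One_nat_def plus_1_eq_Suc)
  \<comment> \<open>With \<open>a = k0 + 1\<close>, the set \<open>expo a k\<close> still has gaps
    at \<open>k = k0 - 1\<close> and none from \<open>k0\<close> on. The drop at \<open>k0\<close>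
    requires \<open>m * (k0 - 1) > 2 * k0 + 1\<close>; the worst case \<open>k0 = 2\<close> needs
    \<open>m > 5\<close>.\<close>
  let ?f = "\<lambda>k. min_gens (ideal_power (I_am (k0 + 1) 6 :: 'k poly poly set) k)"
  \<comment> \<open>Without gaps the count is the size of \<open>expo\<close>, which grows with
    \<open>k\<close>; this gives the increase after \<open>k0\<close>.\<close>
  have large: "?f k = k * (k0 + 2) + 1" if "k \<ge> k0" for k
    using that assms by (simp add: min_gens_I_am_power expo_large)
  have "?f (k0 - 1) = k0\<^sup>2 + 6 * ((k0 - 1) * (k0 + 2) + 1 - k0\<^sup>2)"
    using assms by (simp add: min_gens_I_am_power card_expo_small)
  also have "(k0 - 1) * (k0 + 2) + 1 - k0\<^sup>2 = k0 - 1"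
    by (simp add: n power2_eq_square algebra_simps)
  finally have "?f (k0 - 1) = k0\<^sup>2 + 6 * (k0 - 1)" .
  moreover have "k0\<^sup>2 + 6 * (k0 - 1) > k0 * (k0 + 2) + 1"
    by (simp add: n power2_eq_square algebra_simps)
  ultimately have "has_local_min_at ?f k0"
    unfolding has_local_min_at_def large[OF order_refl] large[OF le_add1] using assms by simp
  then show ?thesis
    using assms by (intro exI[of _ "k0 + 1"] exI[of _ 6]) simp
qed

end
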